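(* Let $p\in(1,\infty)$, $X\in\mathfrak A_p$, $\theta\in[0,p)$, $S\in\mathcal{LCR}_\theta(X)$ closed, and $\{\mathfrak m_k\}\in\mathfrak M^{str}_\theta(S)$ with parameter $\epsilon\in(0,\frac1{10}]$. Let $f\in L^1_{loc}(\{\mathfrak m_k\})$ (a fixed Borel representative on $S$) satisfy $\operatorname{BSN}^\delta_{p,c}(f)<+\infty$ for some $c>1$ and $\delta\in(0,1]$. Then $\mathfrak m_0$-almost every point of $S$ is an $(\{\mathfrak m_k\},\epsilon)$-Lebesgue point of $f$, i.e. $\mathfrak m_0(S\setminus\mathfrak R_{\{\mathfrak m_k\},\epsilon}(f))=0$.
   Context: A metric measure space is a triple $X=(X,d,\mu)$ with $(X,d)$ a complete separable metric space and $\mu$ a Borel regular measure with $0<\mu(B)<\infty$ for every ball $B$ and $\operatorname{supp}\mu=X$. All balls are closed: $B_r(x)=\{y:d(x,y)\le r\}$; $\lambda B_r(x)=B_{\lambda r}(x)$, $r(B)$ is the radius. A measure on $X$ means a nonzero Borel regular locally finite (outer) measure. $\mu$ is uniformly locally doubling if for every $R>0$, $\sup_{r\in(0,R]}\sup_x\mu(B_{2r}(x))/\mu(B_r(x))<\infty$. $\operatorname{lip}f(x)=\limsup_{y\to x}|f(y)-f(x)|/d(x,y)$ at accumulation points and $0$ otherwise. For a measure $\mathfrak m$ and Borel $G$ with $0<\mathfrak m(G)<\infty$, $\mathcal E_{\mathfrak m}(f,G)=\inf_{c\in\mathbb R}\frac1{\mathfrak m(G)}\int_G|f-c|d\mathfrak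 m$. $X\in\mathfrak A_q$ if $\mu$ is uniformly locally doubling and for every $R>0$ there are $C>0,\lambda\ge1$ with $\mathcal E_\mu(f,B_r(x))\le Cr(\frac1{\mu(B_{\lambda r}(x))}\int_{B_{\lambda r}(x)}(\operatorname{lip}f)^qd\mu)^{1/q}$ for all Lipschitz $f$, $x$, $r\in(0,R]$. For $\theta\ge0$: $\mathcal H_{\theta,\delta}(E)=\inf\{\sum_i\mu(B_{r_i}(x_i))/r_i^\theta:E\subset\bigcup_iB_{r_i}(x_i),\ r_i<\delta\}$. $S\in\mathcal{LCR}_\theta(X)$ if there is $\lambda>0$ with $\mathcal H_{\theta,r}(B_r(x)\cap S)\ge\lambda\mu(B_r(x))/r^\theta$ for all $x\in S$, $r\in(0,1]$. $\{\mathfrak m_k\}_{k=0}^\infty\in\mathfrak M_\theta(S)$ (parameter $\epsilon$) means: (M1) $\operatorname{supp}\mathfrak m_k=S$; (M2) $\exists C_1$: $\mathfrak m_k(B_r(x))\le C_1\mu(B_r(x))/r^\theta$ for all $k$, $x\in X$, $r\in(0,\epsilon^k]$; (M3) $\exists C_2$: $\mathfrak m_k(B_r(x))\ge C_2\mu(B_r(x))/r^\theta$ for all $k$, $x\in S$, $r\in[\epsilon^k,1]$; (M4) $\mathfrak m_k=w_k\mathfrak m_0$, $w_k\in L^\infty(\mathfrak m_0)$, $\exists C_3$: $\epsilon^{\theta j}/C_3\le w_k/w_{k+j}\le C_3$ $\mathfrak m_0$-a.e. on $S$ for all $k,j$. $\mathfrak M^{str}_\theta(S)$ additionally requires (M5):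 for every Borel $E\subset S$, $\limsup_k\mathfrak m_k(B_{\epsilon^k}(x)\cap E)/\mathfrak m_k(B_{\epsilon^k}(x))>0$ for $\mathfrak m_0$-a.e. $x\in E$. $L^1_{loc}(\{\mathfrak m_k\})=\bigcap_kL^1_{loc}(\mathfrak m_k)$. For $r>0$, $k(r)=\max\{k\in\mathbb Z:r\le\epsilon^k\}$; $k(B)=k(r(B))$. $\widetilde{\mathcal E}_{\mathfrak m}(f,B_r(x))=\mathcal E_{\mathfrak m}(f,B_{2r}(x))$ if $B_r(x)\cap\operatorname{supp}\mathfrak m\ne\emptyset$, else $0$. A finite family of closed balls $\{B_{r_i}(x_i)\}$ is $(S,c,\delta)$-nice if the balls are pairwise disjoint, $\max_ir_i\le\delta$, and $B_{cr_i}(x_i)\cap S\ne\emptyset$ for all $i$. $\operatorname{BSN}^\delta_{p,c}(f)=\|f\|_{L^p(\mathfrak m_0)}+\sup\big(\sum_{B\in\mathcal B}\mu(B)r(B)^{-p}\widetilde{\mathcal E}_{\mathfrak m_{k(B)}}(f,cB)^p\big)^{1/p}$, supremum over all $(S,c,\delta)$-nice families. A point $x\in S$ is an $(\{\mathfrak m_k\},\epsilon)$-Lebesgue point of $f$ if $\lim_{r\to0}\frac1{\mathfrak m_{k(r)}(B_r(x))}\int_{B_r(x)}|f(x)-f(y)|\,d\mathfrak m_{k(r)}(y)=0$; $\mathfrak R_{\{\mathfrak m_k\},\epsilon}(f)$ is the set of such points. *)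

theory Defs
  imports "HOL-Analysis.Analysis" "HOL-Library.Liminf_Limsup"
begin

definition epowr :: "ennreal \<Rightarrow> real \<Rightarrow> ennreal" where
  "epowr t a = (if t = \<infinity> then \<infinity> else ennreal (enn2real t powr a))"

definition msupp :: "'a::metric_space measure \<Rightarrow> 'a set" where
  "msupp M = {x. \<forall>r>0. emeasure M (ball x r) > 0}"

definition is_meas :: "'a::metric_space measure \<Rightarrow> bool" where
  "is_meas M \<longleftrightarrow> sets M = sets borel \<and> emeasure M UNIV \<noteq> 0 \<and>
     (\<forall>x. \<exists>U. open U \<and> x \<in> U \<and> emeasure M U < \<infinity>)"

definition mms :: "'a::polish_space measure \<Rightarrow> bool" where
  "mms \<mu> \<longleftrightarrow> sets \<mu> = sets borel \<and>
     (\<forall>x r. r > 0 \<longrightarrow> 0 < emeasure \<mu> (cball x r) \<and> emeasure \<mu> (cball x r) < \<infinity>)"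

definition unif_loc_doubling :: "'a::metric_space measure \<Rightarrow> bool" where
  "unif_loc_doubling \<mu> \<longleftrightarrow> (\<forall>R>0. \<exists>K. \<forall>r. 0 < r \<and> r \<le> R \<longrightarrow>
     (\<forall>x. measure \<mu> (cball x (2*r)) \<le> K * measure \<mu> (cball x r)))"

definition lip :: "('a::metric_space \<Rightarrow> real) \<Rightarrow> 'a \<Rightarrow> real" where
  "lip f x = (if x islimpt (UNIV::'a set)
     then real_of_ereal (Limsup (at x) (\<lambda>y. ereal (\<bar>f y - f x\<bar> / dist x y))) else 0)"

definition osc :: "'a measure \<Rightarrow> ('a \<Rightarrow> real) \<Rightarrow> 'a set \<Rightarrow> ennreal" where
  "osc m f G = (INF c::real. (\<integral>\<^sup>+ y\<in>G. ennreal \<bar>f y - c\<bar> \<partial>m) / emeasure m G)"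

definition in_A :: "real \<Rightarrow> 'a::polish_space measure \<Rightarrow> bool" where
  "in_A q \<mu> \<longleftrightarrow> mms \<mu> \<and> unif_loc_doubling \<mu> \<and>
     (\<forall>R>0. \<exists>C>0. \<exists>lam\<ge>1. \<forall>f x r. (\<exists>L. L-lipschitz_on UNIV f) \<and> 0 < r \<and> r \<le> R \<longrightarrow>
        osc \<mu> f (cball x r) \<le> ennreal (C * r) *
          epowr ((\<integral>\<^sup>+ y\<in>cball x (lam*r). ennreal (lip f y powr q) \<partial>\<mu>)
                   / emeasure \<mu> (cball x (lam*r))) (1/q))"

definition hcont :: "'a::metric_space measure \<Rightarrow> real \<Rightarrow> real \<Rightarrow> 'a set \<Rightarrow> ennreal" where
  "hcont \<mu> \<theta> \<delta> E = (INF (I, x, r) \<in> {(I::nat set, x::nat \<Rightarrow> 'a, r::nat \<Rightarrow> real).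
        (\<forall>i\<in>I. 0 < r i \<and> r i < \<delta>) \<and> E \<subseteq> (\<Union>i\<in>I. cball (x i) (r i))}.
      suminf (\<lambda>i. if i \<in> I then ennreal (measure \<mu> (cball (x i) (r i)) / r i powr \<theta>) else 0))"

definition LCR :: "'a::metric_space measure \<Rightarrow> real \<Rightarrow> 'a set \<Rightarrow> bool" where
  "LCR \<mu> \<theta> S \<longleftrightarrow> (\<exists>lam>0. \<forall>x\<in>S. \<forall>r. 0 < r \<and> r \<le> 1 \<longrightarrow>
     hcont \<mu> \<theta> r (cball x r \<inter> S) \<ge> ennreal (lam * measure \<mu> (cball x r) / r powr \<theta>))"

definition M_str :: "'a::metric_space measure \<Rightarrow> real \<Rightarrow> 'a set \<Rightarrow> real \<Rightarrow>
    (nat \<Rightarrow> 'a measure) \<Rightarrow> (nat \<Rightarrow> 'a \<Rightarrow> real) \<Rightarrow> bool" where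
  "M_str \<mu> \<theta> S \<epsilon> m w \<longleftrightarrow>
     (\<forall>k. is_meas (m k)) \<and>
     (\<forall>k. msupp (m k) = S) \<and>
     (\<exists>C1. \<forall>k x r. 0 < r \<and> r \<le> \<epsilon>^k \<longrightarrow>
        emeasure (m k) (cball x r) \<le> ennreal (C1 * measure \<mu> (cball x r) / r powr \<theta>)) \<and>
     (\<exists>C2>0. \<forall>k. \<forall>x\<in>S. \<forall>r. \<epsilon>^k \<le> r \<and> r \<le> 1 \<longrightarrow>
        emeasure (m k) (cball x r) \<ge> ennreal (C2 * measure \<mu> (cball x r) / r powr \<theta>)) \<and>
     (\<forall>k. w k \<in> borel_measurable (m 0) \<and> (AE x in m 0. 0 \<le> w k x) \<and>
          (\<exists>K. AE x in m 0. \<bar>w k x\<bar> \<le> K) \<and>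
          m k = density (m 0) (\<lambda>x. ennreal (w k x))) \<and>
     (\<exists>C3>0. \<forall>k j. AE x in m 0. x \<in> S \<longrightarrow>
          \<epsilon> powr (\<theta> * real j) / C3 \<le> w k x / w (k+j) x \<and> w k x / w (k+j) x \<le> C3) \<and>
     (\<forall>E. E \<in> sets borel \<and> E \<subseteq> S \<longrightarrow> (AE x in m 0. x \<in> E \<longrightarrow>
          limsup (\<lambda>k. ereal (measure (m k) (cball x (\<epsilon>^k) \<inter> E) / measure (m k) (cball x (\<epsilon>^k)))) > 0))"

definition kr :: "real \<Rightarrow> real \<Rightarrow> int" where
  "kr \<epsilon> r = (GREATEST k::int. r \<le> \<epsilon> powi k)"

definition osc_t :: "'a::metric_space measure \<Rightarrow> ('a \<Rightarrow> real) \<Rightarrow> 'a \<Rightarrow> real \<Rightarrow> ennreal" where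
  "osc_t m f x r = (if cball x r \<inter> msupp m \<noteq> {} then osc m f (cball x (2*r)) else 0)"

definition nice :: "'a::metric_space set \<Rightarrow> real \<Rightarrow> real \<Rightarrow> ('a \<times> real) set \<Rightarrow> bool" where
  "nice S c \<delta> F \<longleftrightarrow> finite F \<and>
     (\<forall>(x,r)\<in>F. 0 < r \<and> r \<le> \<delta> \<and> cball x (c*r) \<inter> S \<noteq> {}) \<and>
     (\<forall>(x,r)\<in>F. \<forall>(y,s)\<in>F. (x,r) \<noteq> (y,s) \<longrightarrow> cball x r \<inter> cball y s = {})"

definition BSN :: "'a::metric_space measure \<Rightarrow> 'a set \<Rightarrow> real \<Rightarrow> (nat \<Rightarrow> 'a measure) \<Rightarrow>
    real \<Rightarrow> real \<Rightarrow> real \<Rightarrow> ('a \<Rightarrow> real) \<Rightarrow> ennreal" where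
  "BSN \<mu> S \<epsilon> m \<delta> p c f =
     epowr (\<integral>\<^sup>+ y. ennreal (\<bar>f y\<bar> powr p) \<partial>(m 0)) (1/p) +
     (SUP F \<in> {F. nice S c \<delta> F}.
        epowr (\<Sum>(x,r)\<in>F. ennreal (measure \<mu> (cball x r) * r powr (-p)) *
                   epowr (osc_t (m (nat (kr \<epsilon> r))) f x (c*r)) p) (1/p))"

definition loc_integrable :: "'a::metric_space measure \<Rightarrow> ('a \<Rightarrow> real) \<Rightarrow> bool" where
  "loc_integrable M f \<longleftrightarrow> (\<forall>x. \<exists>r>0. set_integrable M (ball x r) f)"

definition leb_point :: "real \<Rightarrow> (nat \<Rightarrow> 'a::metric_space measure) \<Rightarrow> ('a \<Rightarrow> real) \<Rightarrow> 'a \<Rightarrow> bool" where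
  "leb_point \<epsilon> m f x \<longleftrightarrow>
     ((\<lambda>r. (\<integral>\<^sup>+ y\<in>cball x r. ennreal \<bar>f x - f y\<bar> \<partial>(m (nat (kr \<epsilon> r))))
            / emeasure (m (nat (kr \<epsilon> r))) (cball x r)) \<longlongrightarrow> 0) (at_right 0)"

end

theory Submission
  imports Defs
begin

text \<open>
  Let \<open>r = \<epsilon>^k\<close> and \<open>s = \<epsilon> powr ((p - \<theta>) / (2 * p))\<close>.  Choose a maximal \<open>2r\<close>-separated subset
  of the points of \<open>S\<close> at which the oscillation of \<open>f\<close> at scale \<open>r\<close> exceeds \<open>s^k\<close>; the balls of radius \<open>r\<close>
  around it form a nice family.  Finiteness of the BSN norm together with (M2) and (M4) then bounds the
  \<open>m 0\<close>-measure of the balls of radius \<open>2r\<close>, which cover the exceptional points, by a multiple of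
  \<open>\<epsilon> powr (k * (p - \<theta>) / 2)\<close>.  By Borel--Cantelli the oscillation at almost every point is
  eventually at most \<open>s^k\<close>, which is summable, so the near-optimal constants \<open>b k\<close> converge.  Their limit
  must be \<open>f x\<close>: otherwise a level set of \<open>f\<close> between two rationals close to \<open>f x\<close> would have relative
  measure tending to \<open>0\<close> in the balls at \<open>x\<close>, against (M5).
\<close>

section \<open>Preliminaries on supports, separated sets, countable unions and densities\<close>

text \<open>The complement of the support is a union of open null sets, and Lindelof's theorem
  reduces it to a countable one.\<close>

lemma AE_in_msupp:
  fixes M :: "'a::{metric_space, second_countable_topology} measure"
  assumes M: "sets M = sets borel"
  shows "AE x in M. x \<in> msupp M"
proof -
  define \<F> where "\<F> = {U. open U \<and> emeasure M U = 0}"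
  obtain \<F>' where F': "\<F>' \<subseteq> \<F>" "countable \<F>'" "\<Union>\<F>' = \<Union>\<F>"
    using Lindelof[of \<F>] unfolding \<F>_def by blast
  have "\<And>U. U \<in> \<F>' \<Longrightarrow> U \<in> null_sets M"
    using F'(1) by (auto simp: \<F>_def null_sets_def M)
  with F'(2) have "(\<Union>U\<in>\<F>'. U) \<in> null_sets M"
    by (rule null_sets_UN')
  hence "\<Union>\<F> \<in> null_sets M" using F'(3) by simp
  moreover have "{x \<in> space M. \<not> x \<in> msupp M} \<subseteq> \<Union>\<F>"
  proof safe
    fix x assume "x \<notin> msupp M"
    then obtain r where "r > 0" "\<not> emeasure M (ball x r) > 0" by (auto simp: msupp_def)
    thus "x \<in> \<Union>\<F>" unfolding \<F>_def by (intro UnionI[of "ball x r"]) auto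
  qed
  ultimately show ?thesis by (rule AE_I')
qed

text \<open>Zorn's lemma gives a maximal separated \<open>N\<close>; a point of \<open>A\<close>
  outside all the balls could still be added to it.\<close>

lemma maximal_separated_subset:
  fixes A :: "'a::metric_space set"
  assumes "0 \<le> d"
  obtains N where "N \<subseteq> A" "\<And>x y. x \<in> N \<Longrightarrow> y \<in> N \<Longrightarrow> x \<noteq> y \<Longrightarrow> d < dist x y"
    "A \<subseteq> (\<Union>x\<in>N. cball x d)"
proof -
  define \<N> where "\<N> = {N. N \<subseteq> A \<and> (\<forall>x\<in>N. \<forall>y\<in>N. x \<noteq> y \<longrightarrow> d < dist x y)}"
  have "\<exists>N\<in>\<N>. \<forall>X\<in>\<N>. N \<subseteq> X \<longrightarrow> X = N"
  proof (rule subset_Zorn')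
    fix C assume C: "subset.chain \<N> C"
    have sub: "C \<subseteq> \<N>" and tot: "\<And>X Y. X \<in> C \<Longrightarrow> Y \<in> C \<Longrightarrow> X \<subseteq> Y \<or> Y \<subseteq> X"
      using C by (auto simp: subset_chain_def)
    show "\<Union>C \<in> \<N>"
      unfolding \<N>_def
    proof (intro CollectI conjI ballI impI)
      show "\<Union>C \<subseteq> A" using sub by (auto simp: \<N>_def)
      fix x y assume "x \<in> \<Union>C" "y \<in> \<Union>C" and ne: "x \<noteq> y"
      then obtain X Y where XY: "X \<in> C" "Y \<in> C" "x \<in> X" "y \<in> Y" by auto
      with tot[of X Y] obtain Z where "Z \<in> C" "x \<in> Z" "y \<in> Z" by auto
      with sub ne show "d < dist x y" by (auto simp: \<N>_def)
    qed
  qed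
  then obtain N where N: "N \<in> \<N>" "\<And>X. X \<in> \<N> \<Longrightarrow> N \<subseteq> X \<Longrightarrow> X = N" by blast
  show thesis
  proof
    show "N \<subseteq> A" "\<And>x y. x \<in> N \<Longrightarrow> y \<in> N \<Longrightarrow> x \<noteq> y \<Longrightarrow> d < dist x y"
      using N(1) by (auto simp: \<N>_def)
    show "A \<subseteq> (\<Union>x\<in>N. cball x d)"
    proof (rule ccontr)
      assume "\<not> A \<subseteq> (\<Union>x\<in>N. cball x d)"
      then obtain z where "z \<in> A" "z \<notin> (\<Union>x\<in>N. cball x d)" by blast
      hence z: "z \<in> A" "\<And>x. x \<in> N \<Longrightarrow> d < dist x z" by (auto simp: not_le)
      hence "insert z N \<in> \<N>" using N(1) by (auto simp: \<N>_def dist_commute)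
      with N(2)[of "insert z N"] have "z \<in> N" by auto
      from z(2)[OF this] assms show False by simp
    qed
  qed
qed

text \<open>Each point is sent to a point of a countable dense set; the radius \<open>d/2\<close>
  makes this map injective on \<open>N\<close>.\<close>

lemma countable_separated:
  fixes N :: "'a::{metric_space, second_countable_topology} set"
  assumes d: "0 < d" and sep: "\<And>x y. x \<in> N \<Longrightarrow> y \<in> N \<Longrightarrow> x \<noteq> y \<Longrightarrow> d < dist x y"
  shows "countable N"
proof -
  obtain D :: "'a set" where D: "countable D" "\<And>X. open X \<Longrightarrow> X \<noteq> {} \<Longrightarrow> \<exists>z\<in>D. z \<in> X"
    using countable_dense_setE by blast
  have "\<exists>z. z \<in> D \<and> z \<in> ball x (d/2)" for x
    using D(2)[of "ball x (d/2)"] d by auto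
  then obtain g where g: "\<And>x. g x \<in> D" "\<And>x. dist x (g x) < d/2"
    by (metis mem_ball)
  have "inj_on g N"
  proof (rule inj_onI, rule ccontr)
    fix x y assume xy: "x \<in> N" "y \<in> N" "g x = g y" "x \<noteq> y"
    have "dist x y \<le> dist x (g x) + dist y (g x)" by (metis dist_triangle2)
    also have "\<dots> < d/2 + d/2" using g(2)[of x] g(2)[of y] xy(3) by (intro add_strict_mono) auto
    finally show False using sep[OF xy(1,2,4)] by simp
  qed
  moreover have "countable (g ` N)" using g(1) D(1) by (meson countable_subset image_subsetI)
  ultimately show ?thesis by (rule countable_image_inj_on[rotated])
qed

text \<open>Nice families are finite while a separated set may be infinite. Continuity from below
  carries a bound that is uniform over finite subfamilies to the whole union.\<close>

lemma emeasure_UN_le_finite_sums: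
  assumes N: "countable N" and B: "\<And>x. x \<in> N \<Longrightarrow> B x \<in> sets M"
    and le: "\<And>F. finite F \<Longrightarrow> F \<subseteq> N \<Longrightarrow> (\<Sum>x\<in>F. emeasure M (B x)) \<le> V"
  shows "emeasure M (\<Union>x\<in>N. B x) \<le> V"
proof (cases "N = {}")
  case False
  \<comment> \<open>The enumeration repeats points when \<open>N\<close> is finite; taking its image
    as a set counts each ball once.\<close>
  define A where "A n = (\<Union>x\<in>from_nat_into N ` {..n}. B x)" for n
  have sub: "from_nat_into N ` {..n} \<subseteq> N" for n using from_nat_into[OF False] by auto
  have A: "range A \<subseteq> sets M"
  proof safe
    fix n show "A n \<in> sets M"
      unfolding A_def using sub B by (intro sets.finite_UN) auto
  qed
  have "incseq A"
    unfolding incseq_def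
  proof (intro allI impI)
    fix i j :: nat assume "i \<le> j"
    hence "from_nat_into N ` {..i} \<subseteq> from_nat_into N ` {..j}" by (intro image_mono) simp
    thus "A i \<subseteq> A j" unfolding A_def by (intro UN_mono) simp_all
  qed
  moreover have "(\<Union>n. A n) = (\<Union>x\<in>N. B x)"
  proof -
    have "(\<Union>n. A n) = (\<Union>n. B (from_nat_into N n))" unfolding A_def by auto
    also have "\<dots> = (\<Union>x\<in>range (from_nat_into N). B x)" by simp
    finally show ?thesis unfolding range_from_nat_into[OF False N] .
  qed
  ultimately have "emeasure M (\<Union>x\<in>N. B x) = (SUP n. emeasure M (A n))"
    using SUP_emeasure_incseq[OF A] by simp
  also have "\<dots> \<le> V"
  proof (rule SUP_least)
    fix n
    have "emeasure M (A n) \<le> (\<Sum>x\<in>from_nat_into N ` {..n}. emeasure M (B x))"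
      unfolding A_def using sub B by (intro emeasure_subadditive_finite) auto
    also have "\<dots> \<le> V" by (rule le[OF _ sub]) auto
    finally show "emeasure M (A n) \<le> V" .
  qed
  finally show ?thesis .
qed auto

text \<open>Used to turn the weight ratios of (M4) into comparisons between the measures
  \<open>m k\<close>.\<close>

lemma nn_integral_density_le:
  assumes [measurable]: "v \<in> borel_measurable M" "w \<in> borel_measurable M" "g \<in> borel_measurable M"
    and "0 \<le> D" and le: "AE x in M. v x \<le> D * w x"
  shows "(\<integral>\<^sup>+ x. g x \<partial>density M (\<lambda>x. ennreal (v x)))
    \<le> ennreal D * (\<integral>\<^sup>+ x. g x \<partial>density M (\<lambda>x. ennreal (w x)))"
proof -
  have "(\<integral>\<^sup>+ x. g x \<partial>density M (\<lambda>x. ennreal (v x))) = (\<integral>\<^sup>+ x. ennreal (v x) * g x \<partial>M)"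
    by (simp add: nn_integral_density)
  also have "\<dots> \<le> (\<integral>\<^sup>+ x. ennreal D * (ennreal (w x) * g x) \<partial>M)"
  proof (rule nn_integral_mono_AE)
    show "AE x in M. ennreal (v x) * g x \<le> ennreal D * (ennreal (w x) * g x)"
      using le
    proof eventually_elim
      case (elim x)
      hence "ennreal (v x) \<le> ennreal D * ennreal (w x)"
        using \<open>0 \<le> D\<close> by (metis ennreal_leI ennreal_mult')
      thus ?case by (metis mult.assoc mult_right_mono zero_le)
    qed
  qed
  also have "\<dots> = ennreal D * (\<integral>\<^sup>+ x. ennreal (w x) * g x \<partial>M)"
    by (simp add: nn_integral_cmult)
  also have "\<dots> = ennreal D * (\<integral>\<^sup>+ x. g x \<partial>density M (\<lambda>x. ennreal (w x)))"
    by (simp add: nn_integral_density)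
  finally show ?thesis .
qed

section \<open>Geometric scales and the index \<open>kr\<close>\<close>

lemma kr_eqI:
  assumes e: "0 < \<epsilon>" "\<epsilon> < 1" and r: "\<epsilon> ^ Suc k < r" "r \<le> \<epsilon> ^ k"
  shows "kr \<epsilon> r = int k"
  unfolding kr_def
proof (rule Greatest_equality)
  show "r \<le> \<epsilon> powi int k" using r by (simp add: power_int_def)
  fix j :: int assume j: "r \<le> \<epsilon> powi j"
  show "j \<le> int k"
  proof (rule ccontr)
    assume "\<not> j \<le> int k"
    hence "nat j \<ge> Suc k" "j \<ge> 0" by auto
    hence "\<epsilon> powi j \<le> \<epsilon> ^ Suc k"
      using e by (simp add: power_int_def power_decreasing del: power_Suc)
    with j r show False by simp
  qed
qed

text \<open>The least \<open>n\<close> with \<open>\<epsilon>^n < r\<close> is not \<open>0\<close>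
  because \<open>r <= 1\<close>, and its predecessor is the required \<open>k\<close>.\<close>

lemma geometric_scale:
  assumes e: "0 < \<epsilon>" "\<epsilon> < (1::real)" and r: "0 < r" "r \<le> 1"
  obtains k where "\<epsilon> ^ Suc k < r" "r \<le> \<epsilon> ^ k"
proof -
  obtain n where n: "\<epsilon> ^ n < r" using real_arch_pow_inv[OF r(1) e(2)] by auto
  define n0 where "n0 = (LEAST n. \<epsilon> ^ n < r)"
  have n0: "\<epsilon> ^ n0 < r" unfolding n0_def using n by (rule LeastI)
  moreover have "n0 \<noteq> 0" using n0 r by (cases "n0 = 0") auto
  then obtain k where k: "n0 = Suc k" using not0_implies_Suc by blast
  moreover have "\<not> \<epsilon> ^ k < r" using not_less_Least[of k "\<lambda>n. \<epsilon> ^ n < r"] k n0_def by simp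
  ultimately show thesis using that[of k] by auto
qed

text \<open>Reduces the limit in \<open>leb_point\<close> to a limit over the index
  \<open>k\<close>; the cast \<open>nat\<close> loses nothing, since \<open>kr\<close> is
  nonnegative for \<open>0 < r <= 1\<close>.\<close>

lemma filterlim_kr:
  assumes e: "0 < \<epsilon>" "\<epsilon> < 1"
  shows "filterlim (\<lambda>r. nat (kr \<epsilon> r)) sequentially (at_right 0)"
  unfolding filterlim_at_top eventually_at_right_field
proof (intro allI exI conjI impI)
  fix K :: nat and r :: real
  show "0 < \<epsilon> ^ K" using e by simp
  assume r: "0 < r" "r < \<epsilon> ^ K"
  have "r \<le> 1" using r(2) e power_le_one[of \<epsilon> K] by linarith
  then obtain k where k: "\<epsilon> ^ Suc k < r" "r \<le> \<epsilon> ^ k" using geometric_scale[OF e r(1)] by blast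
  have "\<epsilon> ^ Suc k < \<epsilon> ^ K" using k r by linarith
  hence "K < Suc k" using e power_strict_decreasing_iff by blast
  thus "K \<le> nat (kr \<epsilon> r)" using kr_eqI[OF e k] by simp
qed

section \<open>Consequences of doubling and of (M1)-(M4) for the measures \<open>m k\<close>\<close>

locale adapted_measures =
  fixes \<mu> :: "'a::polish_space measure" and \<theta> :: real and S :: "'a set" and \<epsilon> :: real
    and m :: "nat \<Rightarrow> 'a measure" and w :: "nat \<Rightarrow> 'a \<Rightarrow> real"
  assumes mms: "mms \<mu>" and doubling: "unif_loc_doubling \<mu>"
    and theta_nonneg: "0 \<le> \<theta>" and eps_pos: "0 < \<epsilon>" and eps_le: "\<epsilon> \<le> 1/10"
    and M_str: "M_str \<mu> \<theta> S \<epsilon> m w"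
begin

lemma eps_less_1: "\<epsilon> < 1"
  using eps_le by simp

text \<open>Here \<open>msupp_m\<close> is (M1), while \<open>density_m\<close> and
  \<open>M4\<close> are the two halves of (M4): the representation by weights and the bound on their
  ratios.\<close>

lemmas M_str_conjs = M_str[unfolded M_str_def]
lemmas is_meas_m = M_str_conjs[THEN conjunct1]
  and msupp_m = M_str_conjs[THEN conjunct2, THEN conjunct1]
  and M2 = M_str_conjs[THEN conjunct2, THEN conjunct2, THEN conjunct1]
  and M3 = M_str_conjs[THEN conjunct2, THEN conjunct2, THEN conjunct2, THEN conjunct1]
  and density_m = M_str_conjs[THEN conjunct2, THEN conjunct2, THEN conjunct2, THEN conjunct2,
    THEN conjunct1]
  and M4 = M_str_conjs[THEN conjunct2, THEN conjunct2, THEN conjunct2, THEN conjunct2,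
    THEN conjunct2, THEN conjunct1]
  and M5 = M_str_conjs[THEN conjunct2, THEN conjunct2, THEN conjunct2, THEN conjunct2,
    THEN conjunct2, THEN conjunct2]

lemma sets_m [measurable_cong, simp]: "sets (m k) = sets borel"
  using is_meas_m by (simp add: is_meas_def)

lemma mu_cball_pos: "0 < r \<Longrightarrow> 0 < measure \<mu> (cball x r)"
  using mms by (simp add: mms_def measure_def enn2real_positive_iff)

lemma mu_cball_mono:
  assumes "0 < s" "r \<le> s"
  shows "measure \<mu> (cball x r) \<le> measure \<mu> (cball x s)"
proof -
  have "sets \<mu> = sets borel" "emeasure \<mu> (cball x s) < \<infinity>" using mms assms by (auto simp: mms_def)
  moreover have "cball x r \<subseteq> cball x s" using assms by (intro subset_cball)
  ultimately show ?thesis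
    unfolding measure_def by (intro enn2real_mono emeasure_mono) simp_all
qed

text \<open>Doubling is iterated \<open>n\<close> times with \<open>a <= 2^n\<close>. All radii met
  on the way are at most \<open>2^n\<close>, so a single doubling constant serves.\<close>

lemma mu_cball_scale:
  obtains K where "0 < K"
    "\<And>x r s. 0 < r \<Longrightarrow> r \<le> 1 \<Longrightarrow> s \<le> a * r \<Longrightarrow> measure \<mu> (cball x s) \<le> K * measure \<mu> (cball x r)"
proof -
  obtain n :: nat where n: "a \<le> 2 ^ n" using real_arch_pow[of 2 a] by (auto intro: less_imp_le)
  have "(2::real) ^ n > 0" by simp
  then obtain K where K: "\<And>r x. 0 < r \<Longrightarrow> r \<le> 2 ^ n \<Longrightarrow>
      measure \<mu> (cball x (2*r)) \<le> K * measure \<mu> (cball x r)"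
    using doubling unfolding unif_loc_doubling_def by meson
  \<comment> \<open>The constant \<open>K\<close> comes without a sign; the maximum with 1 is
    positive, as the monotonicity steps require.\<close>
  define L where "L = max K 1"
  have L: "measure \<mu> (cball x (2*r)) \<le> L * measure \<mu> (cball x r)" if "0 < r" "r \<le> 2 ^ n" for r x
    using K[OF that, of x] mu_cball_pos[OF that(1), of x]
    by (metis L_def max.cobounded1 mult_le_cancel_right_pos order_trans)
  have L0: "0 < L" by (simp add: L_def)
  have iter: "measure \<mu> (cball x (2^i*r)) \<le> L^i * measure \<mu> (cball x r)"
    if "0 < r" "r \<le> 1" "i \<le> n" for i r x
    using that(3)
  proof (induction i)
    case (Suc i)
    have "2 ^ i * r \<le> 2 ^ n * 1" using Suc that by (intro mult_mono) (auto intro: power_increasing)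
    hence "measure \<mu> (cball x (2*(2^i*r))) \<le> L * measure \<mu> (cball x (2^i*r))"
      using that by (intro L) auto
    also have "\<dots> \<le> L * (L^i * measure \<mu> (cball x r))"
      using Suc L0 by (intro mult_left_mono) auto
    finally show ?case by (simp add: mult.assoc)
  qed auto
  show thesis
  proof
    show "0 < L ^ n" using L0 by simp
    fix x r s assume r: "0 < r" "r \<le> 1" "s \<le> a * r"
    have "s \<le> 2^n * r" using r n by (meson mult_right_mono order_trans less_imp_le)
    hence "measure \<mu> (cball x s) \<le> measure \<mu> (cball x (2^n*r))"
      using r by (intro mu_cball_mono) auto
    also have "\<dots> \<le> L^n * measure \<mu> (cball x r)" using r by (intro iter) auto
    finally show "measure \<mu> (cball x s) \<le> L^n * measure \<mu> (cball x r)" .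
  qed
qed

text \<open>(M2) does not fix the sign of its constant; later products of constants need a positive
  one.\<close>

lemma m_cball_upper:
  obtains C where "0 < C"
    "\<And>k x r. 0 < r \<Longrightarrow> r \<le> \<epsilon>^k \<Longrightarrow>
      emeasure (m k) (cball x r) \<le> ennreal (C * measure \<mu> (cball x r) / r powr \<theta>)"
proof -
  obtain C where C: "\<And>k x r. 0 < r \<Longrightarrow> r \<le> \<epsilon>^k \<Longrightarrow>
      emeasure (m k) (cball x r) \<le> ennreal (C * measure \<mu> (cball x r) / r powr \<theta>)"
    using M2 by blast
  show thesis
  proof
    show "0 < max C 1" by simp
    fix k x r assume r: "0 < r" "r \<le> \<epsilon>^k"
    show "emeasure (m k) (cball x r) \<le> ennreal (max C 1 * measure \<mu> (cball x r) / r powr \<theta>)"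
      by (rule order_trans[OF C[OF r]])
        (intro ennreal_leI divide_right_mono mult_right_mono; simp)
  qed
qed

lemma m_cball_lower:
  obtains C where "0 < C"
    "\<And>k x r. x \<in> S \<Longrightarrow> \<epsilon>^k \<le> r \<Longrightarrow> r \<le> 1 \<Longrightarrow>
      ennreal (C * measure \<mu> (cball x r) / r powr \<theta>) \<le> emeasure (m k) (cball x r)"
  using M3 by blast

lemma m_cball_finite:
  assumes "0 < r" "r \<le> \<epsilon>^k"
  shows "emeasure (m k) (cball x r) < \<infinity>"
  using m_cball_upper assms by (metis ennreal_less_top infinity_ennreal_def order_le_less_trans)

lemma AE_in_S: "AE x in m 0. x \<in> S"
  using AE_in_msupp[of "m 0"] msupp_m by simp

text \<open>This is (M4) with the denominators cleared, which requires that \<open>w (k+j)\<close>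
  is positive almost everywhere.\<close>

lemma weight_bounds:
  obtains C where "0 < C"
    "\<And>k j. AE x in m 0. w k x \<le> C * w (k+j) x \<and> w (k+j) x \<le> C / \<epsilon> powr (\<theta> * real j) * w k x"
proof -
  obtain C where C: "0 < C" "\<And>k j. AE x in m 0. x \<in> S \<longrightarrow>
          \<epsilon> powr (\<theta> * real j) / C \<le> w k x / w (k+j) x \<and> w k x / w (k+j) x \<le> C"
    using M4 by blast
  have pos: "AE x in m 0. 0 \<le> w k x" for k using density_m by blast
  show thesis
  proof (rule that[OF C(1)])
    fix k j
    show "AE x in m 0. w k x \<le> C * w (k+j) x \<and> w (k+j) x \<le> C / \<epsilon> powr (\<theta> * real j) * w k x"
      using C(2)[where k=k and j=j] AE_in_S pos[of "k+j"]
    proof eventually_elim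
      case (elim x)
      have e: "0 < \<epsilon> powr (\<theta> * real j)" using eps_pos by simp
      have q: "\<epsilon> powr (\<theta> * real j) / C \<le> w k x / w (k+j) x" "w k x / w (k+j) x \<le> C"
        using elim by auto
      \<comment> \<open>Division by zero yields \<open>0\<close>, so a positive quotient excludes a
        vanishing denominator.\<close>
      have "0 < w k x / w (k+j) x" using q(1) e C(1) by (smt (verit) divide_pos_pos)
      hence "w (k+j) x \<noteq> 0" by auto
      with elim have "0 < w (k+j) x" by linarith
      with q e C(1) show ?case by (simp add: field_simps)
    qed
  qed
qed

text \<open>A coarse measure is dominated by every finer one with a constant independent of the gap
  \<open>j\<close>. The reverse comparison loses a factor depending on \<open>j\<close>, which is
  harmless for fixed \<open>j\<close>.\<close>

lemma nn_integral_m_compare: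
  obtains C where "0 < C"
    "\<And>k j g. g \<in> borel_measurable borel \<Longrightarrow>
      (\<integral>\<^sup>+x. g x \<partial>m k) \<le> ennreal C * (\<integral>\<^sup>+x. g x \<partial>m (k+j))"
    "\<And>k j g. g \<in> borel_measurable borel \<Longrightarrow>
      (\<integral>\<^sup>+x. g x \<partial>m (k+j)) \<le> ennreal (C / \<epsilon> powr (\<theta> * real j)) * (\<integral>\<^sup>+x. g x \<partial>m k)"
proof -
  have w: "w k \<in> borel_measurable (m 0)" "density (m 0) (\<lambda>x. ennreal (w k x)) = m k" for k
    using density_m by metis+
  obtain C where C: "0 < C" "\<And>k j. AE x in m 0. w k x \<le> C * w (k+j) x \<and>
      w (k+j) x \<le> C / \<epsilon> powr (\<theta> * real j) * w k x"
    by (rule weight_bounds) blast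
  show thesis
  proof (rule that[OF C(1)])
    fix k j and g :: "'a \<Rightarrow> ennreal" assume g: "g \<in> borel_measurable borel"
    hence g': "g \<in> borel_measurable (m 0)" by (simp add: measurable_cong_sets[OF sets_m refl])
    have AE: "AE x in m 0. w k x \<le> C * w (k+j) x"
      "AE x in m 0. w (k+j) x \<le> C / \<epsilon> powr (\<theta> * real j) * w k x"
      using C(2)[of k j] by (auto elim!: eventually_mono)
    show "(\<integral>\<^sup>+x. g x \<partial>m k) \<le> ennreal C * (\<integral>\<^sup>+x. g x \<partial>m (k+j))"
      using nn_integral_density_le[OF w(1) w(1) g' _ AE(1)] C(1) by (simp add: w(2))
    show "(\<integral>\<^sup>+x. g x \<partial>m (k+j)) \<le> ennreal (C / \<epsilon> powr (\<theta> * real j)) * (\<integral>\<^sup>+x. g x \<partial>m k)"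
      using nn_integral_density_le[OF w(1) w(1) g' _ AE(2)] C(1) by (simp add: w(2))
  qed
qed

text \<open>The radius \<open>a * \<epsilon>^k\<close> may be too large for (M2) at index
  \<open>k\<close>, so the estimate descends to the coarser \<open>m (k-j)\<close>. Doubling then
  shrinks the ball, and (M3) returns to \<open>m (Suc k)\<close> at its smallest admissible
  radius.\<close>

lemma m_cball_compare:
  assumes a: "1 \<le> a"
  obtains C j where "0 < C"
    "\<And>k x. x \<in> S \<Longrightarrow> j \<le> k \<Longrightarrow>
      emeasure (m k) (cball x (a * \<epsilon>^k)) \<le> ennreal C * emeasure (m (Suc k)) (cball x (\<epsilon>^Suc k))"
proof -
  \<comment> \<open>With \<open>a * \<epsilon>^j < 1\<close>, the radius
    \<open>a * \<epsilon>^k\<close> falls in the range of (M2) for \<open>m (k-j)\<close>.\<close>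
  obtain j where j: "\<epsilon> ^ j < 1 / a" using real_arch_pow_inv[of "1/a" \<epsilon>] a eps_less_1 by auto
  obtain K where K: "0 < K" "\<And>x r s. 0 < r \<Longrightarrow> r \<le> 1 \<Longrightarrow> s \<le> (a/\<epsilon>) * r \<Longrightarrow>
      measure \<mu> (cball x s) \<le> K * measure \<mu> (cball x r)"
    by (rule mu_cball_scale[of "a/\<epsilon>"]) blast
  obtain U where U: "0 < U" "\<And>k x r. 0 < r \<Longrightarrow> r \<le> \<epsilon>^k \<Longrightarrow>
      emeasure (m k) (cball x r) \<le> ennreal (U * measure \<mu> (cball x r) / r powr \<theta>)"
    by (rule m_cball_upper) blast
  obtain L where L: "0 < L" "\<And>k x r. x \<in> S \<Longrightarrow> \<epsilon>^k \<le> r \<Longrightarrow> r \<le> 1 \<Longrightarrow>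
      ennreal (L * measure \<mu> (cball x r) / r powr \<theta>) \<le> emeasure (m k) (cball x r)"
    by (rule m_cball_lower) blast
  obtain D where D: "0 < D" "\<And>k j g. g \<in> borel_measurable borel \<Longrightarrow>
      (\<integral>\<^sup>+x. g x \<partial>m (k+j)) \<le> ennreal (D / \<epsilon> powr (\<theta> * real j)) * (\<integral>\<^sup>+x. g x \<partial>m k)"
    using nn_integral_m_compare by metis
  define D' where "D' = D / \<epsilon> powr (\<theta> * real j)"
  have D': "0 < D'" using D(1) eps_pos by (simp add: D'_def)
  show thesis
  proof
    show "0 < D' * (U * K / L)" using D' U(1) K(1) L(1) by simp
    fix k x assume x: "x \<in> S" and jk: "j \<le> k"
    define r where "r = \<epsilon> ^ Suc k"
    define s where "s = a * \<epsilon> ^ k"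
    have r: "0 < r" "r \<le> 1" unfolding r_def
      using eps_pos eps_less_1 by (auto intro!: power_le_one simp del: power_Suc)
    have s: "s = a / \<epsilon> * r" unfolding s_def r_def using eps_pos by simp
    have s0: "0 < s" unfolding s_def using a eps_pos by simp
    have "a * \<epsilon>^j \<le> 1" using j a by (simp add: field_simps)
    hence "a * \<epsilon>^j * \<epsilon>^(k-j) \<le> 1 * \<epsilon>^(k-j)" using eps_pos by (intro mult_right_mono) auto
    hence sle: "s \<le> \<epsilon> ^ (k-j)" unfolding s_def using jk by (simp add: mult.assoc flip: power_add)
    have rs: "r \<le> s"
    proof -
      have "r \<le> 1 * \<epsilon>^k" unfolding r_def using eps_pos eps_less_1 by simp
      also have "\<dots> \<le> s" unfolding s_def using a eps_pos by (intro mult_right_mono) auto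
      finally show ?thesis .
    qed
    have "emeasure (m k) (cball x s) \<le> ennreal D' * emeasure (m (k-j)) (cball x s)"
      using D(2)[OF borel_measurable_indicator[of "cball x s"], of "k-j" j] jk by (simp add: D'_def)
    also have "\<dots> \<le> ennreal D' * ennreal (U * measure \<mu> (cball x s) / s powr \<theta>)"
      using U(2)[OF s0 sle] by (intro mult_left_mono) auto
    also have "\<dots> \<le> ennreal D' * ennreal ((U * K / L) * (L * measure \<mu> (cball x r) / r powr \<theta>))"
    proof (intro mult_left_mono ennreal_leI)
      \<comment> \<open>Since \<open>r <= s\<close> and \<open>\<theta>\<close> is nonnegative, the
        denominator may be lowered from \<open>s powr \<theta>\<close> to
        \<open>r powr \<theta>\<close>.\<close>
      have "U * measure \<mu> (cball x s) / s powr \<theta> \<le> U * (K * measure \<mu> (cball x r)) / r powr \<theta>"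
        using U(1) K(2)[OF r, of s x] s r s0 rs theta_nonneg K(1) mu_cball_pos[OF r(1), of x]
        by (intro frac_le mult_left_mono powr_mono2) auto
      also have "\<dots> = (U * K / L) * (L * measure \<mu> (cball x r) / r powr \<theta>)"
        using L(1) by simp
      finally show "U * measure \<mu> (cball x s) / s powr \<theta> \<le> \<dots>" .
    qed simp
    also have "\<dots> = ennreal (D' * (U * K / L)) * ennreal (L * measure \<mu> (cball x r) / r powr \<theta>)"
      using D' U(1) K(1) L(1) by (simp add: ennreal_mult'' flip: mult.assoc ennreal_mult')
    also have "\<dots> \<le> ennreal (D' * (U * K / L)) * emeasure (m (Suc k)) (cball x r)"
      using L(2)[OF x _ r(2), of "Suc k"] by (intro mult_left_mono) (auto simp: r_def)
    finally show "emeasure (m k) (cball x (a * \<epsilon>^k))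
        \<le> ennreal (D' * (U * K / L)) * emeasure (m (Suc k)) (cball x (\<epsilon>^Suc k))"
      by (simp add: s_def r_def)
  qed
qed

lemma m_cball_pos:
  assumes "x \<in> S" "0 < r"
  shows "0 < emeasure (m k) (cball x r)"
proof -
  have "0 < emeasure (m k) (ball x r)" using msupp_m assms by (auto simp: msupp_def)
  also have "\<dots> \<le> emeasure (m k) (cball x r)" by (intro emeasure_mono) auto
  finally show ?thesis .
qed

end

section \<open>From a finite BSN norm to small oscillation almost everywhere\<close>

lemma epowr_mono: "t \<le> u \<Longrightarrow> 0 \<le> a \<Longrightarrow> epowr t a \<le> epowr u a"
  unfolding epowr_def
  by (auto simp: top.extremum_uniqueI less_top intro!: ennreal_leI powr_mono2 enn2real_mono)

text \<open>Undoes the outer power \<open>1/p\<close>, leaving one real bound for the sums over all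
  nice families.\<close>

lemma BSN_finite_imp_sums_bounded:
  assumes p: "0 < p" and fin: "BSN \<mu> S \<epsilon> m \<delta> p c f < \<infinity>"
  obtains V where "0 \<le> V" "\<And>F. nice S c \<delta> F \<Longrightarrow>
    (\<Sum>(x,r)\<in>F. ennreal (measure \<mu> (cball x r) * r powr (-p)) *
                   epowr (osc_t (m (nat (kr \<epsilon> r))) f x (c*r)) p) \<le> ennreal V"
proof -
  define T where "T F = (\<Sum>(x,r)\<in>F. ennreal (measure \<mu> (cball x r) * r powr (-p)) *
                   epowr (osc_t (m (nat (kr \<epsilon> r))) f x (c*r)) p)" for F
  define W where "W = (SUP F \<in> {F. nice S c \<delta> F}. epowr (T F) (1/p))"
  have W: "W < \<infinity>"
    using fin unfolding BSN_def W_def T_def by (simp add: less_top)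
  show thesis
  proof
    show "0 \<le> enn2real W powr p" by simp
    fix F assume "nice S c \<delta> F"
    hence le: "epowr (T F) (1/p) \<le> W" unfolding W_def by (intro SUP_upper) auto
    \<comment> \<open>An infinite sum is excluded because \<open>epowr\<close> maps
      \<open>\<infinity>\<close> to \<open>\<infinity>\<close>.\<close>
    with W have fT: "T F \<noteq> \<infinity>" by (auto simp: epowr_def)
    hence "enn2real (T F) powr (1/p) \<le> enn2real W"
      using enn2real_mono[OF le] W by (simp add: epowr_def)
    hence "(enn2real (T F) powr (1/p)) powr p \<le> enn2real W powr p"
      using p by (intro powr_mono2) auto
    hence "enn2real (T F) \<le> enn2real W powr p" using p by (simp add: powr_powr)
    thus "(\<Sum>(x,r)\<in>F. ennreal (measure \<mu> (cball x r) * r powr (-p)) *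
        epowr (osc_t (m (nat (kr \<epsilon> r))) f x (c*r)) p) \<le> ennreal (enn2real W powr p)"
      using fT unfolding T_def[symmetric]
      by (metis ennreal_enn2real ennreal_leI infinity_ennreal_def less_top)
  qed
qed

context adapted_measures
begin

text \<open>The estimate concerns a Borel cover \<open>U\<close>, so measurability of the set of
  large oscillation need not be established.\<close>

lemma large_oscillation_cover:
  assumes p: "0 < p" "\<theta> < p" and c: "0 < c" and fin: "BSN \<mu> S \<epsilon> m \<delta> p c f < \<infinity>"
  obtains A where "0 \<le> A" "\<And>k. 1 \<le> k \<Longrightarrow> \<epsilon>^k \<le> \<delta> \<Longrightarrow> \<exists>U \<in> sets borel.
    {x\<in>S. ennreal ((\<epsilon> powr ((p-\<theta>)/(2*p)))^k) < osc_t (m k) f x (c*\<epsilon>^k)} \<subseteq> U \<and>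
    emeasure (m 0) U \<le> ennreal (A * (\<epsilon> powr ((p-\<theta>)/2))^k)"
proof -
  obtain V where V: "0 \<le> V" "\<And>F. nice S c \<delta> F \<Longrightarrow>
    (\<Sum>(x,r)\<in>F. ennreal (measure \<mu> (cball x r) * r powr (-p)) *
                   epowr (osc_t (m (nat (kr \<epsilon> r))) f x (c*r)) p) \<le> ennreal V"
    by (rule BSN_finite_imp_sums_bounded[OF p(1) fin]) blast
  obtain K where K: "0 < K" "\<And>x r s. 0 < r \<Longrightarrow> r \<le> 1 \<Longrightarrow> s \<le> 2 * r \<Longrightarrow>
      measure \<mu> (cball x s) \<le> K * measure \<mu> (cball x r)"
    by (rule mu_cball_scale[of 2]) blast
  obtain U where U: "0 < U" "\<And>k x r. 0 < r \<Longrightarrow> r \<le> \<epsilon>^k \<Longrightarrow>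
      emeasure (m k) (cball x r) \<le> ennreal (U * measure \<mu> (cball x r) / r powr \<theta>)"
    by (rule m_cball_upper) blast
  obtain D where D: "0 < D" "\<And>k j g. g \<in> borel_measurable borel \<Longrightarrow>
      (\<integral>\<^sup>+x. g x \<partial>m k) \<le> ennreal D * (\<integral>\<^sup>+x. g x \<partial>m (k+j))"
    by (rule nn_integral_m_compare) blast
  \<comment> \<open>The factors come from the comparison of \<open>m 0\<close> with finer measures,
    from (M2) and from doubling; none depends on \<open>k\<close>.\<close>
  define A where "A = D * U * K"
  have A: "0 < A" using D(1) U(1) K(1) by (simp add: A_def)
  show thesis
  proof
    show "0 \<le> A * V" using A V(1) by simp
    fix k :: nat assume k: "1 \<le> k" and kd: "\<epsilon>^k \<le> \<delta>"
    define r where "r = \<epsilon>^k"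
    define t where "t = (\<epsilon> powr ((p-\<theta>)/(2*p)))^k"
    define q where "q = (\<epsilon> powr ((p-\<theta>)/2))^k"
    have r: "0 < r" "r \<le> 1" unfolding r_def using eps_pos eps_less_1 by (auto intro!: power_le_one)
    have t: "0 < t" using eps_pos by (simp add: t_def)
    have kr: "nat (kr \<epsilon> r) = k"
      using kr_eqI[of \<epsilon> k r] eps_pos eps_less_1 by (simp add: r_def)
    \<comment> \<open>The factor \<open>r powr (p-\<theta>)\<close> is split into two equal halves.
      One is \<open>t powr p\<close>, absorbed by the oscillation; the other is \<open>q\<close>,
      the geometric gain.\<close>
    have tq: "r powr (-\<theta>) = q * (r powr (-p) * t powr p)"
    proof -
      have "r = \<epsilon> powr real k" "t = \<epsilon> powr (real k * ((p-\<theta>)/(2*p)))"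
        "q = \<epsilon> powr (real k * ((p-\<theta>)/2))"
        using eps_pos by (simp_all add: r_def t_def q_def powr_realpow powr_power mult.commute)
      thus ?thesis
        using p(1) by (simp add: powr_powr flip: powr_add) (simp add: field_simps)
    qed
    have q: "0 \<le> q" by (simp add: q_def)
    define Bad where "Bad = {x\<in>S. ennreal t < osc_t (m k) f x (c*r)}"
    have "0 \<le> 2 * r" using r by simp
    then obtain N where N: "N \<subseteq> Bad" "\<And>x y. x \<in> N \<Longrightarrow> y \<in> N \<Longrightarrow> x \<noteq> y \<Longrightarrow> 2 * r < dist x y"
        "Bad \<subseteq> (\<Union>x\<in>N. cball x (2*r))"
      using maximal_separated_subset[of "2*r" Bad] by blast
    have cN: "countable N" using N(2) r by (intro countable_separated[of "2*r"]) auto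
    have ball: "emeasure (m 0) (cball x (2*r)) \<le> ennreal (A * q) *
      (ennreal (measure \<mu> (cball x r) * r powr (-p)) * epowr (osc_t (m k) f x (c*r)) p)"
      if x: "x \<in> N" for x
    proof -
      \<comment> \<open>Compare with \<open>m (k-1)\<close>: for \<open>m k\<close>, (M2) only covers radii up to \<open>r\<close>, not \<open>2r\<close>.\<close>
      have "2 * \<epsilon> * \<epsilon>^(k-1) \<le> 1 * \<epsilon>^(k-1)"
        using eps_pos eps_le by (intro mult_right_mono) auto
      hence r2: "2 * r \<le> \<epsilon>^(k-1)"
        unfolding r_def using k by (simp add: mult.assoc flip: power_Suc)
      have "emeasure (m 0) (cball x (2*r)) \<le> ennreal D * emeasure (m (k-1)) (cball x (2*r))"
        using D(2)[OF borel_measurable_indicator[of "cball x (2*r)"], of 0 "k-1"] by simp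
      also have "\<dots> \<le> ennreal D * ennreal (U * measure \<mu> (cball x (2*r)) / (2*r) powr \<theta>)"
        using U(2)[OF _ r2] r by (intro mult_left_mono) auto
      also have "\<dots> \<le> ennreal D * ennreal (U * (K * measure \<mu> (cball x r)) / r powr \<theta>)"
        using U(1) K r theta_nonneg mu_cball_pos[OF r(1), of x]
        by (intro mult_left_mono ennreal_leI frac_le powr_mono2) auto
      also have "\<dots> = ennreal (A * (measure \<mu> (cball x r) * r powr (-\<theta>)))"
        using D(1) by (simp add: A_def powr_minus field_simps flip: ennreal_mult')
      also have "\<dots> = ennreal (A * q) *
          (ennreal (measure \<mu> (cball x r) * r powr (-p)) * ennreal (t powr p))"
        unfolding tq using A q by (simp add: mult_ac flip: ennreal_mult')
      also have "\<dots> \<le> ennreal (A * q) *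
          (ennreal (measure \<mu> (cball x r) * r powr (-p)) * epowr (osc_t (m k) f x (c*r)) p)"
      proof (intro mult_left_mono)
        have "ennreal (t powr p) = epowr (ennreal t) p" using t by (simp add: epowr_def)
        also have "\<dots> \<le> epowr (osc_t (m k) f x (c*r)) p"
          using x N(1) p by (intro epowr_mono) (auto simp: Bad_def)
        finally show "ennreal (t powr p) \<le> epowr (osc_t (m k) f x (c*r)) p" .
      qed auto
      finally show ?thesis .
    qed
    have "emeasure (m 0) (\<Union>x\<in>N. cball x (2*r)) \<le> ennreal (A * q) * ennreal V"
    proof (rule emeasure_UN_le_finite_sums[OF cN])
      fix F assume F: "finite F" "F \<subseteq> N"
      define G where "G = (\<lambda>x. (x,r)) ` F"
      have nice: "nice S c \<delta> G"
        unfolding nice_def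
      proof (intro conjI)
        show "finite G" using F by (simp add: G_def)
        \<comment> \<open>The centers lie in \<open>S\<close>, so they witness the intersection
          condition themselves.\<close>
        have "x \<in> cball x (c*r) \<inter> S" if "x \<in> F" for x
          using that F(2) N(1) c r by (auto simp: Bad_def)
        thus "\<forall>(x, r)\<in>G. 0 < r \<and> r \<le> \<delta> \<and> cball x (c * r) \<inter> S \<noteq> {}"
          using r kd unfolding r_def G_def by blast
        have "cball x r \<inter> cball y r = {}" if "x \<in> F" "y \<in> F" "x \<noteq> y" for x y
        proof -
          have "r + r < dist x y" using N(2)[of x y] that F by auto
          thus ?thesis by (rule disjoint_cballI)
        qed
        thus "\<forall>(x, r)\<in>G. \<forall>(y, s)\<in>G. (x, r) \<noteq> (y, s) \<longrightarrow> cball x r \<inter> cball y s = {}"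
          unfolding G_def by auto
      qed
      have "(\<Sum>x\<in>F. emeasure (m 0) (cball x (2*r))) \<le> (\<Sum>x\<in>F. ennreal (A * q) *
          (ennreal (measure \<mu> (cball x r) * r powr (-p)) * epowr (osc_t (m k) f x (c*r)) p))"
        using F(2) by (intro sum_mono ball) auto
      also have "\<dots> = ennreal (A * q) * (\<Sum>(x,r)\<in>G.
          ennreal (measure \<mu> (cball x r) * r powr (-p)) *
            epowr (osc_t (m (nat (kr \<epsilon> r))) f x (c*r)) p)"
        unfolding G_def by (subst sum.reindex) (auto simp: inj_on_def sum_distrib_left kr)
      also have "\<dots> \<le> ennreal (A * q) * ennreal V"
        by (intro mult_left_mono V(2) nice) auto
      finally show "(\<Sum>x\<in>F. emeasure (m 0) (cball x (2*r))) \<le> ennreal (A * q) * ennreal V" .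
    qed simp
    also have "\<dots> = ennreal (A * V * q)" using A q V(1) by (simp add: mult_ac flip: ennreal_mult')
    finally have "emeasure (m 0) (\<Union>x\<in>N. cball x (2*r)) \<le> ennreal (A * V * q)" .
    moreover have "(\<Union>x\<in>N. cball x (2*r)) \<in> sets borel"
      using cN by (intro sets.countable_UN') auto
    ultimately show "\<exists>U \<in> sets borel.
        {x\<in>S. ennreal ((\<epsilon> powr ((p-\<theta>)/(2*p)))^k) < osc_t (m k) f x (c*\<epsilon>^k)} \<subseteq> U \<and>
        emeasure (m 0) U \<le> ennreal (A * V * (\<epsilon> powr ((p-\<theta>)/2))^k)"
      using N(3) unfolding Bad_def r_def t_def q_def by blast
  qed
qed

text \<open>The measures of the covers are dominated by a geometric series, whose ratio
  \<open>q\<close> is below 1 because \<open>\<theta> < p\<close>.\<close>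

lemma AE_eventually_small_oscillation:
  assumes p: "0 < p" "\<theta> < p" and c: "0 < c" and "0 < \<delta>" and fin: "BSN \<mu> S \<epsilon> m \<delta> p c f < \<infinity>"
  shows "AE x in m 0. \<forall>\<^sub>F k in sequentially.
    osc_t (m k) f x (c*\<epsilon>^k) \<le> ennreal ((\<epsilon> powr ((p-\<theta>)/(2*p)))^k)"
proof -
  define q where "q = \<epsilon> powr ((p-\<theta>)/2)"
  define Bad where "Bad k = {x\<in>S. ennreal ((\<epsilon> powr ((p-\<theta>)/(2*p)))^k) < osc_t (m k) f x (c*\<epsilon>^k)}"
    for k
  obtain A where A: "0 \<le> A" "\<And>k. 1 \<le> k \<Longrightarrow> \<epsilon>^k \<le> \<delta> \<Longrightarrow>
      \<exists>U \<in> sets borel. Bad k \<subseteq> U \<and> emeasure (m 0) U \<le> ennreal (A * q^k)"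
    unfolding Bad_def q_def by (rule large_oscillation_cover[OF p c fin]) blast
  have q: "0 < q" "q < 1"
    using eps_pos eps_less_1 p powr_less_mono2[of "(p-\<theta>)/2" \<epsilon> 1] by (auto simp: q_def)
  obtain k1 where "\<epsilon>^k1 < \<delta>" using real_arch_pow_inv[OF \<open>0 < \<delta>\<close> eps_less_1] by blast
  \<comment> \<open>Beyond \<open>k0\<close> both requirements of the covering lemma hold:
    \<open>k\<close> is at least 1, and the radius is at most \<open>\<delta>\<close>.\<close>
  define k0 where "k0 = max 1 k1"
  have k0: "1 \<le> k" "\<epsilon>^k \<le> \<delta>" if "k0 \<le> k" for k
  proof -
    show "1 \<le> k" using that by (simp add: k0_def)
    have "\<epsilon>^k \<le> \<epsilon>^k1"
      using eps_pos eps_less_1 that by (intro power_decreasing) (auto simp: k0_def)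
    with \<open>\<epsilon>^k1 < \<delta>\<close> show "\<epsilon>^k \<le> \<delta>" by simp
  qed
  have "\<exists>U. k0 \<le> k \<longrightarrow> U \<in> sets borel \<and> Bad k \<subseteq> U \<and> emeasure (m 0) U \<le> ennreal (A * q^k)"
    for k using A(2)[OF k0] by blast
  then obtain U where U: "\<And>k. k0 \<le> k \<Longrightarrow> U k \<in> sets borel"
      "\<And>k. k0 \<le> k \<Longrightarrow> Bad k \<subseteq> U k" "\<And>k. k0 \<le> k \<Longrightarrow> emeasure (m 0) (U k) \<le> ennreal (A * q^k)"
    by metis
  have meas: "measure (m 0) (U (n + k0)) \<le> A * q^(n+k0)" for n
    using U(3)[of "n+k0"] A(1) q by (simp add: measure_def enn2real_leI)
  have "AE x in m 0. \<forall>\<^sub>F n in sequentially. x \<in> space (m 0) - U (n + k0)"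
  proof (rule borel_cantelli_AE1)
    show "U (n + k0) \<in> sets (m 0)" for n using U(1)[of "n+k0"] by simp
    show "emeasure (m 0) (U (n + k0)) < \<infinity>" for n
      using U(3)[of "n+k0"] by (simp add: order_le_less_trans[OF _ ennreal_less_top])
    have "summable (\<lambda>n. A * q^(n+k0))"
      using q by (intro summable_mult summable_ignore_initial_segment summable_geometric) auto
    thus "summable (\<lambda>n. measure (m 0) (U (n + k0)))"
      by (rule summable_comparison_test') (use meas in simp)
  qed
  with AE_in_S show ?thesis
  proof eventually_elim
    case (elim x)
    have "\<forall>\<^sub>F n in sequentially. osc_t (m (n+k0)) f x (c*\<epsilon>^(n+k0))
        \<le> ennreal ((\<epsilon> powr ((p-\<theta>)/(2*p)))^(n+k0))"
      using elim(2)
    proof eventually_elim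
      case (elim n)
      with U(2)[of "n+k0"] have "x \<notin> Bad (n+k0)" by auto
      with \<open>x \<in> S\<close> show ?case by (simp add: Bad_def not_less)
    qed
    thus ?case by (rule eventually_sequentially_seg[THEN iffD1])
  qed
qed

end

section \<open>Mean deviation from a constant\<close>

lemma nn_integral_deviation_le:
  fixes f :: "'a \<Rightarrow> real"
  assumes [measurable]: "f \<in> borel_measurable M" "B \<in> sets M"
  shows "(\<integral>\<^sup>+y\<in>B. ennreal \<bar>f y - a\<bar> \<partial>M)
    \<le> (\<integral>\<^sup>+y\<in>B. ennreal \<bar>f y - b\<bar> \<partial>M) + ennreal \<bar>a - b\<bar> * emeasure M B"
proof -
  have "(\<integral>\<^sup>+y\<in>B. ennreal \<bar>f y - a\<bar> \<partial>M)
    \<le> (\<integral>\<^sup>+y. ennreal \<bar>f y - b\<bar> * indicator B y + ennreal \<bar>a - b\<bar> * indicator B y \<partial>M)"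
    by (intro nn_integral_mono)
      (auto split: split_indicator intro!: ennreal_leI simp flip: ennreal_plus)
  also have "\<dots> = (\<integral>\<^sup>+y\<in>B. ennreal \<bar>f y - b\<bar> \<partial>M) + ennreal \<bar>a - b\<bar> * emeasure M B"
    by (subst nn_integral_add) (auto simp: nn_integral_cmult_indicator)
  finally show ?thesis .
qed

text \<open>The triangle inequality through \<open>f y\<close> is integrated over \<open>B\<close>,
  whose mass is positive and finite and hence cancels.\<close>

lemma constants_dist_le:
  fixes f :: "'a \<Rightarrow> real"
  assumes [measurable]: "f \<in> borel_measurable M" "B \<in> sets M"
    and B: "0 < emeasure M B" "emeasure M B < \<infinity>"
    and a: "(\<integral>\<^sup>+y\<in>B. ennreal \<bar>f y - a\<bar> \<partial>M) \<le> ennreal s * emeasure M B" "0 \<le> s"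
    and b: "(\<integral>\<^sup>+y\<in>B. ennreal \<bar>f y - b\<bar> \<partial>M) \<le> ennreal t * emeasure M B" "0 \<le> t"
  shows "\<bar>a - b\<bar> \<le> s + t"
proof -
  have "ennreal \<bar>a - b\<bar> * emeasure M B = (\<integral>\<^sup>+y. ennreal \<bar>a - b\<bar> * indicator B y \<partial>M)"
    by (simp add: nn_integral_cmult_indicator)
  also have "\<dots> \<le> (\<integral>\<^sup>+y. ennreal \<bar>f y - a\<bar> * indicator B y + ennreal \<bar>f y - b\<bar> * indicator B y \<partial>M)"
    by (intro nn_integral_mono)
      (auto split: split_indicator intro!: ennreal_leI simp flip: ennreal_plus)
  also have "\<dots> = (\<integral>\<^sup>+y\<in>B. ennreal \<bar>f y - a\<bar> \<partial>M) + (\<integral>\<^sup>+y\<in>B. ennreal \<bar>f y - b\<bar> \<partial>M)"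
    by (subst nn_integral_add) auto
  also have "\<dots> \<le> ennreal s * emeasure M B + ennreal t * emeasure M B"
    using a b by (intro add_mono) auto
  also have "\<dots> = ennreal (s + t) * emeasure M B" using a b by (simp add: distrib_right)
  finally have "emeasure M B * ennreal \<bar>a - b\<bar> \<le> emeasure M B * ennreal (s + t)"
    by (simp add: mult.commute)
  thus ?thesis using B a(2) b(2) by (simp add: ennreal_mult_le_mult_iff flip: ennreal_plus)
qed

text \<open>Chebyshev's inequality on \<open>B \<inter> E\<close>; it makes level sets of
  \<open>f\<close> away from \<open>b\<close> thin in \<open>B\<close>.\<close>

lemma relative_measure_le:
  fixes f :: "'a \<Rightarrow> real"
  assumes [measurable]: "f \<in> borel_measurable M" "B \<in> sets M" "E \<in> sets M"
    and B: "0 < emeasure M B" "emeasure M B < \<infinity>"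
    and b: "(\<integral>\<^sup>+y\<in>B. ennreal \<bar>f y - b\<bar> \<partial>M) \<le> ennreal t * emeasure M B" "0 \<le> t"
    and h: "0 < h" "\<And>y. y \<in> E \<Longrightarrow> h \<le> \<bar>f y - b\<bar>"
  shows "measure M (B \<inter> E) / measure M B \<le> t / h"
proof -
  have fin: "emeasure M (B \<inter> E) < \<infinity>"
    using emeasure_mono[of "B \<inter> E" B M] B(2) by (auto simp: order_le_less_trans)
  have mB: "0 < measure M B" using B by (simp add: measure_def enn2real_positive_iff)
  have "ennreal h * emeasure M (B \<inter> E) = (\<integral>\<^sup>+y. ennreal h * indicator (B \<inter> E) y \<partial>M)"
    by (simp add: nn_integral_cmult_indicator)
  also have "\<dots> \<le> (\<integral>\<^sup>+y\<in>B. ennreal \<bar>f y - b\<bar> \<partial>M)"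
    by (intro nn_integral_mono) (auto split: split_indicator intro!: ennreal_leI h)
  also have "\<dots> \<le> ennreal t * emeasure M B" by (fact b)
  finally have "ennreal (h * measure M (B \<inter> E)) \<le> ennreal (t * measure M B)"
    using fin B b h by (simp add: emeasure_eq_ennreal_measure ennreal_mult less_top[symmetric])
  hence "h * measure M (B \<inter> E) \<le> t * measure M B" using b mB by simp
  thus ?thesis using mB h by (simp add: field_simps)
qed

section \<open>Near-optimal constants across scales and a criterion for Lebesgue points\<close>

context adapted_measures
begin

text \<open>One constant \<open>b\<close> serves all radii of generation \<open>k\<close> for
  \<open>m k\<close>, and also the first ball of the next generation for \<open>m (Suc k)\<close>.
  The second estimate is the link to the constant chosen at \<open>Suc k\<close>.\<close>

lemma near_constant_of_small_oscillation:
  assumes c: "1 \<le> c" and f: "f \<in> borel_measurable borel"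
  obtains D j where "0 < D"
    "\<And>k x t. x \<in> S \<Longrightarrow> j \<le> k \<Longrightarrow> 0 < t \<Longrightarrow> osc_t (m k) f x (c*\<epsilon>^k) \<le> ennreal t \<Longrightarrow>
      \<exists>b. (\<forall>r. \<epsilon>^Suc k \<le> r \<and> r \<le> \<epsilon>^k \<longrightarrow> (\<integral>\<^sup>+y\<in>cball x r. ennreal \<bar>f y - b\<bar> \<partial>m k)
                \<le> ennreal (D * t) * emeasure (m k) (cball x r)) \<and>
          (\<integral>\<^sup>+y\<in>cball x (\<epsilon>^Suc k). ennreal \<bar>f y - b\<bar> \<partial>m (Suc k))
                \<le> ennreal (D * t) * emeasure (m (Suc k)) (cball x (\<epsilon>^Suc k))"
proof -
  obtain C j where C: "0 < C" "\<And>k x. x \<in> S \<Longrightarrow> j \<le> k \<Longrightarrow>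
      emeasure (m k) (cball x (2*c * \<epsilon>^k)) \<le> ennreal C * emeasure (m (Suc k)) (cball x (\<epsilon>^Suc k))"
    by (rule m_cball_compare[of "2*c"]) (use c in auto)
  obtain D where D: "0 < D" "\<And>k j g. g \<in> borel_measurable borel \<Longrightarrow>
      (\<integral>\<^sup>+x. g x \<partial>m (k+j)) \<le> ennreal (D / \<epsilon> powr (\<theta> * real j)) * (\<integral>\<^sup>+x. g x \<partial>m k)"
    by (rule nn_integral_m_compare) blast
  define C' where "C' = D / \<epsilon> powr \<theta>"
  have C': "0 < C'" using D(1) eps_pos by (simp add: C'_def)
  have step: "(\<integral>\<^sup>+x. g x \<partial>m (Suc k)) \<le> ennreal C' * (\<integral>\<^sup>+x. g x \<partial>m k)"
    if "g \<in> borel_measurable borel" for g k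
    using D(2)[OF that, of k 1] by (simp add: C'_def)
  show thesis
  proof
    show "0 < C' * (2 * C)" using C C' by simp
    fix k x t assume x: "x \<in> S" and k: "j \<le> k" and t: "0 < t"
      and osc: "osc_t (m k) f x (c*\<epsilon>^k) \<le> ennreal t"
    \<comment> \<open>This is the reference mass: it controls \<open>m k\<close> on the large ball
      \<open>B\<close> from above, and is itself controlled by \<open>m k\<close> on the smaller
      balls.\<close>
    define M where "M = emeasure (m (Suc k)) (cball x (\<epsilon>^Suc k))"
    define B where "B = cball x (2*c*\<epsilon>^k)"
    have cpos: "0 < c * \<epsilon>^k" using c eps_pos by simp
    hence "cball x (c*\<epsilon>^k) \<inter> msupp (m k) \<noteq> {}" using x msupp_m by force
    hence "osc_t (m k) f x (c*\<epsilon>^k) = osc (m k) f B"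
      unfolding osc_t_def B_def by (simp add: mult.assoc)
    with osc have "osc (m k) f B \<le> ennreal t" by simp
    \<comment> \<open>The infimum in \<open>osc\<close> need not be attained; the slack from
      \<open>t\<close> to \<open>2*t\<close> yields an actual constant.\<close>
    also have "\<dots> < ennreal (2*t)" using t by (simp add: ennreal_lessI)
    finally obtain b where b: "(\<integral>\<^sup>+y\<in>B. ennreal \<bar>f y - b\<bar> \<partial>m k) / emeasure (m k) B < ennreal (2*t)"
      unfolding osc_def by (auto simp: INF_less_iff)
    \<comment> \<open>The radius of \<open>B\<close> exceeds \<open>\<epsilon>^k\<close>, outside
      the range of (M2) for \<open>m k\<close>, so finiteness is inherited from
      \<open>M\<close>.\<close>
    have "M < \<infinity>" unfolding M_def using eps_pos by (intro m_cball_finite) auto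
    hence "ennreal C * M < \<infinity>" by (simp add: ennreal_mult_less_top)
    hence Bfin: "emeasure (m k) B < \<infinity>"
      using C(2)[OF x k] by (simp add: B_def M_def order_le_less_trans)
    have Bpos: "0 < emeasure (m k) B" unfolding B_def using x cpos by (intro m_cball_pos) auto
    have "(\<integral>\<^sup>+y\<in>B. ennreal \<bar>f y - b\<bar> \<partial>m k)
        = (\<integral>\<^sup>+y\<in>B. ennreal \<bar>f y - b\<bar> \<partial>m k) / emeasure (m k) B * emeasure (m k) B"
      using Bpos Bfin by (simp add: ennreal_divide_times ennreal_times_divide flip: ennreal_mult_divide_eq)
    also have "\<dots> \<le> ennreal (2*t) * emeasure (m k) B" using b by (intro mult_right_mono) auto
    also have "\<dots> \<le> ennreal (2*t) * (ennreal C * M)"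
      using C(2)[OF x k] by (intro mult_left_mono) (auto simp: B_def M_def)
    also have "\<dots> = ennreal (2*C*t) * M"
      using C t by (simp add: ennreal_mult mult_ac)
    finally have int: "(\<integral>\<^sup>+y\<in>B. ennreal \<bar>f y - b\<bar> \<partial>m k) \<le> ennreal (2*C*t) * M" .
    have sub: "(\<integral>\<^sup>+y\<in>cball x r. ennreal \<bar>f y - b\<bar> \<partial>m k) \<le> ennreal (2*C*t) * M" if "r \<le> \<epsilon>^k" for r
    proof -
      have "1 * \<epsilon>^k \<le> (2*c) * \<epsilon>^k" using c eps_pos by (intro mult_right_mono) auto
      hence "cball x r \<subseteq> B" unfolding B_def using that by (intro subset_cball) auto
      hence "(\<integral>\<^sup>+y\<in>cball x r. ennreal \<bar>f y - b\<bar> \<partial>m k) \<le> (\<integral>\<^sup>+y\<in>B. ennreal \<bar>f y - b\<bar> \<partial>m k)"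
        by (intro nn_integral_mono) (auto split: split_indicator)
      with int show ?thesis by (rule order_trans[rotated])
    qed
    show "\<exists>b. (\<forall>r. \<epsilon>^Suc k \<le> r \<and> r \<le> \<epsilon>^k \<longrightarrow> (\<integral>\<^sup>+y\<in>cball x r. ennreal \<bar>f y - b\<bar> \<partial>m k)
                \<le> ennreal (C' * (2*C)*t) * emeasure (m k) (cball x r)) \<and>
          (\<integral>\<^sup>+y\<in>cball x (\<epsilon>^Suc k). ennreal \<bar>f y - b\<bar> \<partial>m (Suc k))
                \<le> ennreal (C' * (2*C)*t) * emeasure (m (Suc k)) (cball x (\<epsilon>^Suc k))"
    proof (intro exI conjI allI impI)
      fix r assume r: "\<epsilon>^Suc k \<le> r \<and> r \<le> \<epsilon>^k"
      \<comment> \<open>One generation of comparison brings the mass back to \<open>m k\<close>,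
        after which the ball may grow to radius \<open>r\<close>.\<close>
      have "M \<le> ennreal C' * emeasure (m k) (cball x (\<epsilon>^Suc k))"
        unfolding M_def using step[OF borel_measurable_indicator[of "cball x (\<epsilon>^Suc k)"]] by simp
      also have "\<dots> \<le> ennreal C' * emeasure (m k) (cball x r)"
        using r by (intro mult_left_mono emeasure_mono subset_cball) auto
      finally have "ennreal (2*C*t) * M \<le> ennreal (2*C*t) * (ennreal C' * emeasure (m k) (cball x r))"
        by (intro mult_left_mono) auto
      also have "\<dots> = ennreal (C' * (2*C)*t) * emeasure (m k) (cball x r)"
        using C C' t by (simp add: ennreal_mult mult_ac)
      finally show "(\<integral>\<^sup>+y\<in>cball x r. ennreal \<bar>f y - b\<bar> \<partial>m k)
          \<le> ennreal (C' * (2*C)*t) * emeasure (m k) (cball x r)"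
        using sub r order_trans by blast
    next
      have "(\<integral>\<^sup>+y\<in>cball x (\<epsilon>^Suc k). ennreal \<bar>f y - b\<bar> \<partial>m (Suc k))
          \<le> ennreal C' * (\<integral>\<^sup>+y\<in>cball x (\<epsilon>^Suc k). ennreal \<bar>f y - b\<bar> \<partial>m k)"
        by (intro step f borel_measurable_times_ennreal measurable_compose[OF _ measurable_ennreal]
            borel_measurable_abs borel_measurable_diff borel_measurable_const
            borel_measurable_indicator) auto
      also have "\<dots> \<le> ennreal C' * (ennreal (2*C*t) * M)"
        using eps_pos eps_less_1 by (intro mult_left_mono sub power_decreasing) auto
      also have "\<dots> = ennreal (C' * (2*C)*t) * M"
        using C C' t by (simp add: ennreal_mult mult_ac)
      finally show "(\<integral>\<^sup>+y\<in>cball x (\<epsilon>^Suc k). ennreal \<bar>f y - b\<bar> \<partial>m (Suc k))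
          \<le> ennreal (C' * (2*C)*t) * emeasure (m (Suc k)) (cball x (\<epsilon>^Suc k))"
        by (simp add: M_def)
    qed
  qed
qed

text \<open>Pointwise part of the argument. The density hypothesis involves only rational levels, so
  that (M5) has to be invoked for countably many sets.\<close>

lemma leb_pointI:
  assumes x: "x \<in> S" and S: "closed S" and c: "1 \<le> c" and f: "f \<in> borel_measurable borel"
    and s: "0 < s" "s < 1"
    and osc: "\<forall>\<^sub>F k in sequentially. osc_t (m k) f x (c*\<epsilon>^k) \<le> ennreal (s^k)"
    and dens: "\<And>a b :: rat. of_rat a < f x \<Longrightarrow> f x < of_rat b \<Longrightarrow>
      limsup (\<lambda>k. ereal (measure (m k) (cball x (\<epsilon>^k) \<inter> {y\<in>S. of_rat a < f y \<and> f y < of_rat b})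
        / measure (m k) (cball x (\<epsilon>^k)))) > 0"
  shows "leb_point \<epsilon> m f x"
proof -
  note [measurable] = f
  obtain D j where D: "0 < D"
    "\<And>k x t. x \<in> S \<Longrightarrow> j \<le> k \<Longrightarrow> 0 < t \<Longrightarrow> osc_t (m k) f x (c*\<epsilon>^k) \<le> ennreal t \<Longrightarrow>
      \<exists>b. (\<forall>r. \<epsilon>^Suc k \<le> r \<and> r \<le> \<epsilon>^k \<longrightarrow> (\<integral>\<^sup>+y\<in>cball x r. ennreal \<bar>f y - b\<bar> \<partial>m k)
                \<le> ennreal (D * t) * emeasure (m k) (cball x r)) \<and>
          (\<integral>\<^sup>+y\<in>cball x (\<epsilon>^Suc k). ennreal \<bar>f y - b\<bar> \<partial>m (Suc k))
                \<le> ennreal (D * t) * emeasure (m (Suc k)) (cball x (\<epsilon>^Suc k))"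
    by (rule near_constant_of_small_oscillation[OF c f]) blast
  obtain k1 where k1: "\<And>k. k1 \<le> k \<Longrightarrow> osc_t (m k) f x (c*\<epsilon>^k) \<le> ennreal (s^k)"
    using osc by (auto simp: eventually_sequentially)
  define k0 where "k0 = max j k1"
  define P where "P k b \<longleftrightarrow>
      (\<forall>r. \<epsilon>^Suc k \<le> r \<and> r \<le> \<epsilon>^k \<longrightarrow> (\<integral>\<^sup>+y\<in>cball x r. ennreal \<bar>f y - b\<bar> \<partial>m k)
                \<le> ennreal (D * s^k) * emeasure (m k) (cball x r)) \<and>
      (\<integral>\<^sup>+y\<in>cball x (\<epsilon>^Suc k). ennreal \<bar>f y - b\<bar> \<partial>m (Suc k))
                \<le> ennreal (D * s^k) * emeasure (m (Suc k)) (cball x (\<epsilon>^Suc k))" for k b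
  have "\<exists>b. k0 \<le> k \<longrightarrow> P k b" for k
    unfolding P_def using D(2)[of x k "s^k"] x s k1[of k] by (auto simp: k0_def)
  then obtain b where "\<And>k. k0 \<le> k \<Longrightarrow> P k (b k)" by metis
  hence b: "\<And>k r. k0 \<le> k \<Longrightarrow> \<epsilon>^Suc k \<le> r \<Longrightarrow> r \<le> \<epsilon>^k \<Longrightarrow>
        (\<integral>\<^sup>+y\<in>cball x r. ennreal \<bar>f y - b k\<bar> \<partial>m k) \<le> ennreal (D * s^k) * emeasure (m k) (cball x r)"
      "\<And>k. k0 \<le> k \<Longrightarrow> (\<integral>\<^sup>+y\<in>cball x (\<epsilon>^Suc k). ennreal \<bar>f y - b k\<bar> \<partial>m (Suc k))
        \<le> ennreal (D * s^k) * emeasure (m (Suc k)) (cball x (\<epsilon>^Suc k))"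
    unfolding P_def by blast+
  have epsk: "0 < \<epsilon>^k" "\<epsilon>^Suc k \<le> \<epsilon>^k" for k
    using eps_pos eps_less_1 by (auto intro: power_decreasing)
  have fm: "f \<in> borel_measurable (m k)" for k by measurable
  have Dlim: "(\<lambda>k. D * s^k) \<longlonglongrightarrow> 0"
    using tendsto_mult_left[OF LIMSEQ_power_zero[of s], of D] s by simp
  have incr: "norm (b (Suc k) - b k) \<le> 2 * D * s^k" if k: "k0 \<le> k" for k
  proof -
    \<comment> \<open>Both constants are tested on the same ball with the same measure
      \<open>m (Suc k)\<close>: \<open>b(1)\<close> at generation \<open>Suc k\<close> and
      \<open>b(2)\<close> at generation \<open>k\<close>.\<close>
    have "\<bar>b (Suc k) - b k\<bar> \<le> D * s^Suc k + D * s^k"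
    proof (rule constants_dist_le[OF fm])
      show "cball x (\<epsilon>^Suc k) \<in> sets (m (Suc k))" by simp
      show "0 < emeasure (m (Suc k)) (cball x (\<epsilon>^Suc k))" using x epsk(1) by (rule m_cball_pos)
      show "emeasure (m (Suc k)) (cball x (\<epsilon>^Suc k)) < \<infinity>"
        using epsk(1) order_refl by (rule m_cball_finite)
      show "(\<integral>\<^sup>+y\<in>cball x (\<epsilon>^Suc k). ennreal \<bar>f y - b (Suc k)\<bar> \<partial>m (Suc k))
          \<le> ennreal (D * s^Suc k) * emeasure (m (Suc k)) (cball x (\<epsilon>^Suc k))"
        using k by (intro b(1) epsk(2) order_refl) simp
      show "(\<integral>\<^sup>+y\<in>cball x (\<epsilon>^Suc k). ennreal \<bar>f y - b k\<bar> \<partial>m (Suc k))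
          \<le> ennreal (D * s^k) * emeasure (m (Suc k)) (cball x (\<epsilon>^Suc k))"
        using k by (rule b(2))
    qed (use D(1) s in simp_all)
    moreover have "D * s^Suc k \<le> D * s^k"
    proof (rule mult_left_mono)
      show "s^Suc k \<le> s^k" by (rule power_decreasing) (use s in simp_all)
    qed (use D(1) in simp)
    ultimately show ?thesis by simp
  qed
  have "summable (\<lambda>k. 2 * D * s^k)" using s by (intro summable_mult summable_geometric) auto
  hence "summable (\<lambda>k. b (Suc k) - b k)" using incr by (rule summable_comparison_test')
  \<comment> \<open>Partial sums of the increments telescope, so their summability gives convergence
    of \<open>b\<close>.\<close>
  hence "(\<lambda>n. (\<Sum>k<n. b (Suc k) - b k)) \<longlonglongrightarrow> (\<Sum>k. b (Suc k) - b k)" by (rule summable_LIMSEQ)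
  hence "(\<lambda>n. b n - b 0 + b 0) \<longlonglongrightarrow> (\<Sum>k. b (Suc k) - b k) + b 0"
    unfolding sum_lessThan_telescope by (intro tendsto_intros)
  then obtain l where l: "b \<longlonglongrightarrow> l" by auto
  have "l = f x"
  proof (rule ccontr)
    assume "l \<noteq> f x"
    \<comment> \<open>A third of the gap suffices: on the level set \<open>f\<close> stays within
      \<open>h\<close> of \<open>f x\<close>, and \<open>b k\<close> is eventually within
      \<open>h\<close> of \<open>l\<close>, which leaves \<open>h\<close> between \<open>f\<close>
      and \<open>b k\<close>.\<close>
    define h where "h = \<bar>l - f x\<bar> / 3"
    have h: "0 < h" using \<open>l \<noteq> f x\<close> by (simp add: h_def)
    obtain a' b' where ab: "f x - h < of_rat a'" "of_rat a' < f x" "f x < of_rat b'" "of_rat b' < f x + h"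
      using of_rat_dense[of "f x - h" "f x"] of_rat_dense[of "f x" "f x + h"] h by auto
    define E where "E = {y\<in>S. of_rat a' < f y \<and> f y < of_rat b'}"
    have [measurable]: "S \<in> sets borel" using S by simp
    have E: "E \<in> sets borel" unfolding E_def by measurable
    have "\<forall>\<^sub>F k in sequentially. \<bar>b k - l\<bar> < h"
      using tendstoD[OF l h] by (simp add: dist_real_def)
    hence "\<forall>\<^sub>F k in sequentially. measure (m k) (cball x (\<epsilon>^k) \<inter> E) / measure (m k) (cball x (\<epsilon>^k))
        \<le> (D * s^k) / h"
      using eventually_ge_at_top[of k0]
    proof eventually_elim
      case (elim k)
      have "h \<le> \<bar>f y - b k\<bar>" if "y \<in> E" for y
      proof -
        have "\<bar>f y - f x\<bar> < h" using that ab by (auto simp: E_def)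
        moreover have "\<bar>l - f x\<bar> = 3 * h" by (simp add: h_def)
        ultimately show ?thesis using elim(1) by linarith
      qed
      thus ?case
        using elim(2) b(1)[of k "\<epsilon>^k"] epsk D(1) s x E h
        by (intro relative_measure_le[of f "m k" _ E "b k"] fm m_cball_pos m_cball_finite) auto
    qed
    hence "limsup (\<lambda>k. ereal (measure (m k) (cball x (\<epsilon>^k) \<inter> E) / measure (m k) (cball x (\<epsilon>^k))))
        \<le> limsup (\<lambda>k. ereal ((D * s^k) / h))"
      by (intro Limsup_mono) (auto elim: eventually_mono)
    also have "\<dots> = 0"
    proof (rule lim_imp_Limsup)
      have "(\<lambda>k. (D * s^k) / h) \<longlonglongrightarrow> 0" using tendsto_divide[OF Dlim tendsto_const[of h]] h by simp
      thus "(\<lambda>k. ereal ((D * s^k) / h)) \<longlonglongrightarrow> 0" by (simp add: zero_ereal_def)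
    qed simp
    finally show False using dens[OF ab(2,3)] by (simp add: E_def)
  qed
  \<comment> \<open>The first term bounds the mean deviation from \<open>b k\<close>, the second the
    cost of replacing \<open>b k\<close> by \<open>f x\<close>; both tend to
    \<open>0\<close>.\<close>
  define u where "u k = D * s^k + \<bar>f x - b k\<bar>" for k
  have "u \<longlonglongrightarrow> 0 + \<bar>f x - f x\<bar>"
    unfolding u_def using l \<open>l = f x\<close> by (intro tendsto_intros Dlim) simp
  hence "(\<lambda>k. ennreal (u k)) \<longlonglongrightarrow> ennreal 0" by (intro tendsto_ennrealI) simp
  hence lim: "((\<lambda>r. ennreal (u (nat (kr \<epsilon> r)))) \<longlongrightarrow> 0) (at_right 0)"
    using filterlim_compose[OF _ filterlim_kr[OF eps_pos eps_less_1]] by fastforce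
  have le: "\<forall>\<^sub>F r in at_right 0. (\<integral>\<^sup>+ y\<in>cball x r. ennreal \<bar>f x - f y\<bar> \<partial>(m (nat (kr \<epsilon> r))))
      / emeasure (m (nat (kr \<epsilon> r))) (cball x r) \<le> ennreal (u (nat (kr \<epsilon> r)))"
    \<comment> \<open>Three conditions hold for small \<open>r\<close>: its generation is at least
      \<open>k0\<close>, and \<open>r\<close> is positive and below 1, as
      \<open>geometric_scale\<close> requires.\<close>
    using filterlim_kr[OF eps_pos eps_less_1, unfolded filterlim_at_top, rule_format, of k0]
      eventually_at_right_less[of 0] eventually_at_right_real[of 0 1, OF zero_less_one]
  proof eventually_elim
    case (elim r)
    then obtain k where k: "\<epsilon>^Suc k < r" "r \<le> \<epsilon>^k"
      using geometric_scale[OF eps_pos eps_less_1, of r] by auto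
    have kk: "nat (kr \<epsilon> r) = k" using kr_eqI[OF eps_pos eps_less_1 k] by simp
    define M where "M = emeasure (m k) (cball x r)"
    have M: "0 < M" "M < \<infinity>" unfolding M_def
      using elim k x by (auto intro!: m_cball_pos m_cball_finite simp del: infinity_ennreal_def)
    have "(\<integral>\<^sup>+ y\<in>cball x r. ennreal \<bar>f x - f y\<bar> \<partial>m k) = (\<integral>\<^sup>+ y\<in>cball x r. ennreal \<bar>f y - f x\<bar> \<partial>m k)"
      by (simp add: abs_minus_commute)
    also have "\<dots> \<le> (\<integral>\<^sup>+ y\<in>cball x r. ennreal \<bar>f y - b k\<bar> \<partial>m k) + ennreal \<bar>f x - b k\<bar> * M"
      unfolding M_def by (intro nn_integral_deviation_le fm) auto
    also have "\<dots> \<le> ennreal (D * s^k) * M + ennreal \<bar>f x - b k\<bar> * M"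
      unfolding M_def using elim k kk by (intro add_right_mono b(1)) auto
    also have "\<dots> = ennreal (u k) * M" using D(1) s by (simp add: u_def distrib_right)
    finally have "(\<integral>\<^sup>+ y\<in>cball x r. ennreal \<bar>f x - f y\<bar> \<partial>m k) / M \<le> ennreal (u k) * M / M"
      by (rule divide_right_mono_ennreal)
    also have "\<dots> = ennreal (u k)" using M by (intro ennreal_mult_divide_eq) auto
    finally show ?case unfolding kk M_def .
  qed
  show ?thesis
    unfolding leb_point_def by (rule tendsto_sandwich[OF _ le tendsto_const lim]) simp
qed

end

section \<open>Almost every point meets the Lebesgue point criterion\<close>

theorem mainTheorem12:
  fixes \<mu> :: "'a::polish_space measure"
    and m :: "nat \<Rightarrow> 'a measure" and w :: "nat \<Rightarrow> 'a \<Rightarrow> real"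
    and f :: "'a \<Rightarrow> real" and S :: "'a set"
    and p \<theta> \<epsilon> c \<delta> :: real
  assumes "1 < p"
    and "in_A p \<mu>"
    and "0 \<le> \<theta>" "\<theta> < p"
    and "closed S" "LCR \<mu> \<theta> S"
    and "0 < \<epsilon>" "\<epsilon> \<le> 1/10"
    and "M_str \<mu> \<theta> S \<epsilon> m w"
    and "f \<in> borel_measurable borel"
    and "\<forall>k. loc_integrable (m k) f"
    and "1 < c" "0 < \<delta>" "\<delta> \<le> 1"
    and "BSN \<mu> S \<epsilon> m \<delta> p c f < \<infinity>"
  shows "AE x in m 0. x \<in> S \<longrightarrow> leb_point \<epsilon> m f x"
proof -
  interpret adapted_measures \<mu> \<theta> S \<epsilon> m w
    using assms by unfold_locales (auto simp only: in_A_def)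
  define s where "s = \<epsilon> powr ((p-\<theta>)/(2*p))"
  have s: "0 < s" "s < 1"
    using assms powr_less_mono2[of "(p-\<theta>)/(2*p)" \<epsilon> 1] by (auto simp: s_def)
  define E where "E a b = {y\<in>S. of_rat a < f y \<and> f y < of_rat b}" for a b
  have "E a b \<in> sets borel" for a b
  proof -
    have [measurable]: "S \<in> sets borel" "f \<in> borel_measurable borel" using assms by auto
    show ?thesis unfolding E_def by measurable
  qed
  moreover have "E a b \<subseteq> S" for a b by (auto simp: E_def)
  ultimately have "AE x in m 0. x \<in> E a b \<longrightarrow>
      limsup (\<lambda>k. ereal (measure (m k) (cball x (\<epsilon>^k) \<inter> E a b) / measure (m k) (cball x (\<epsilon>^k)))) > 0"
    for a b using M5 by blast
  \<comment> \<open>The indices \<open>a\<close> and \<open>b\<close> range over the countable type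
    \<open>rat\<close>, so the exceptional null sets can be united.\<close>
  hence "AE x in m 0. \<forall>a b. x \<in> E a b \<longrightarrow>
      limsup (\<lambda>k. ereal (measure (m k) (cball x (\<epsilon>^k) \<inter> E a b) / measure (m k) (cball x (\<epsilon>^k)))) > 0"
    by (simp add: AE_all_countable)
  moreover have "AE x in m 0. \<forall>\<^sub>F k in sequentially. osc_t (m k) f x (c*\<epsilon>^k) \<le> ennreal (s^k)"
    unfolding s_def using assms by (intro AE_eventually_small_oscillation) auto
  ultimately show ?thesis
  proof eventually_elim
    case (elim x)
    show ?case
    proof
      assume x: "x \<in> S"
      show "leb_point \<epsilon> m f x"
        using elim(1) x assms unfolding E_def
        by (intro leb_pointI[OF x _ _ _ s elim(2)]) auto
    qed
  qed
qed

end
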